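(* For every integer $n\ge 0$ and all real numbers $x,y$, $$D_{n}^{(c)}(x,y)=\sum_{m=0}^{[\frac{n}{2}]}\sum_{k=2m}^{n}\binom{n}{k}\binom{k}{2m}D_{n-k}(-1)^{m}y^{2m}x^{k-2m}.$$
   Context: The cosine-derangement polynomials $D_n^{(c)}(x,y)$, $n\ge 0$, are defined by the generating function (power series in $t$) $\displaystyle\frac{e^{-t}}{1-t}e^{xt}\cos(yt)=\sum_{n=0}^{\infty}D_{n}^{(c)}(x,y)\frac{t^{n}}{n!}$. $D_n$ denotes the derangement number, i.e. the number of fixed-point-free permutations of an $n$-element set ($D_0=1$); equivalently $D_n=n!\sum_{k=0}^n\frac{(-1)^k}{k!}$, with $\sum_{n\ge 0}D_n\frac{t^n}{n!}=\frac{e^{-t}}{1-t}$. $[a]$ denotes the greatest integer not exceeding $a$. Convention: $0^0=1$. *)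

theory Defs
  imports
    Complex_Main
    "HOL-Computational_Algebra.Formal_Power_Series"
    "HOL-Combinatorics.Permutations"
begin

definition derangement_number :: "nat \<Rightarrow> nat" where
  "derangement_number n = card {p. p permutes {..<n} \<and> (\<forall>i<n. p i \<noteq> i)}"

definition cos_derangement_gf :: "real \<Rightarrow> real \<Rightarrow> real fps" where
  "cos_derangement_gf x y = fps_exp (- 1) / (1 - fps_X) * fps_exp x * fps_cos y"

definition cos_derangement_poly :: "nat \<Rightarrow> real \<Rightarrow> real \<Rightarrow> real" where
  "cos_derangement_poly n x y = fact n * fps_nth (cos_derangement_gf x y) n"

lemma cos_derangement_gf_eq:
  "fps_exp (- 1) / (1 - fps_X) * fps_exp x * fps_cos y
     = Abs_fps (\<lambda>n. cos_derangement_poly n x y / fact n)"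
  by (simp add: fps_eq_iff cos_derangement_poly_def cos_derangement_gf_def)

end

theory Submission
  imports Defs
begin

text \<open>
  Write \<open>D(t)\<close> for the exponential generating function of the derangement numbers. The polynomials
  come from \<open>e\<^sup>-\<^sup>t / (1 - t) * e\<^sup>x\<^sup>t * cos (y t)\<close>, so once the first factor is known to be \<open>D(t)\<close>, the
  formula is the coefficient of \<open>t\<^sup>n / n!\<close> in a product of three series: \<open>2 * m\<close> is the exponent
  contributed by the even series \<open>cos (y t)\<close>, \<open>k - 2 * m\<close> the one contributed by \<open>e\<^sup>x\<^sup>t\<close>, and \<open>n - k\<close>
  is left for \<open>D(t)\<close>. The factorials combine to \<open>n! / ((n - k)! (k - 2 * m)! (2 * m)!)\<close>, which is the
  product of the two binomial coefficients.

  The combinatorial input is \<open>D(t) = e\<^sup>-\<^sup>t / (1 - t)\<close> (\<open>derangement_egf\<close>), since the derangement numbers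
  are defined by counting permutations. A permutation of a finite set is determined by the set of
  points that it moves together with a derangement of that set, whence
  \<open>n! = (\<Sum>k\<le>n. (n choose k) * D\<^sub>k)\<close> (\<open>fact_eq_sum_derangement_number\<close>); this says exactly that
  \<open>D(t) * e\<^sup>t = 1 / (1 - t)\<close>.
\<close>

unbundle fps_syntax

lemma card_derangements:
  assumes "finite A"
  shows "card {p. p permutes A \<and> (\<forall>a\<in>A. p a \<noteq> a)} = derangement_number (card A)"
proof -
  obtain f where "bij_betw f A {..<card A}"
    using ex_bij_betw_finite_nat[OF assms] by (auto simp: atLeast0LessThan)
  from bij_betw_same_card[OF bij_betw_derangements[OF this]] show ?thesis
    by (simp add: derangement_number_def Ball_def)
qed

lemma sum_Pow_card:
  fixes g :: "nat \<Rightarrow> 'b::semiring_1"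
  assumes "finite A"
  shows "(\<Sum>S\<in>Pow A. g (card S)) = (\<Sum>k\<le>card A. of_nat (card A choose k) * g k)"
proof -
  have "(\<Sum>S\<in>Pow A. g (card S)) = (\<Sum>k\<le>card A. \<Sum>S | S \<in> Pow A \<and> card S = k. g (card S))"
    using assms by (intro sum.group[symmetric]) (auto intro: card_mono)
  also have "\<dots> = (\<Sum>k\<le>card A. of_nat (card A choose k) * g k)"
    using n_subsets[OF assms] by (intro sum.cong) (auto simp: Pow_def)
  finally show ?thesis .
qed

text \<open>
  Classify the permutations of \<open>{..<n}\<close> by their set of moved points: those that move exactly \<open>S\<close>
  are the derangements of \<open>S\<close>, and there are \<open>n choose k\<close> sets \<open>S\<close> of size \<open>k\<close>.
\<close>
lemma fact_eq_sum_derangement_number: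
  "fact n = (\<Sum>k\<le>n. (n choose k) * derangement_number k)"
proof -
  let ?A = "{..<n}"
  let ?moved = "\<lambda>p. {a. p a \<noteq> a}"
  have moved: "{p. p permutes ?A \<and> ?moved p = S} = {p. p permutes S \<and> (\<forall>a\<in>S. p a \<noteq> a)}"
    if "S \<in> Pow ?A" for S
  proof (intro Collect_cong iffI conjI; elim conjE)
    fix p assume p: "p permutes ?A" "?moved p = S"
    from p(2) show "\<forall>a\<in>S. p a \<noteq> a" by auto
    from p show "p permutes S" by (intro permutes_superset[of p ?A S]) auto
  next
    fix p assume p: "p permutes S" "\<forall>a\<in>S. p a \<noteq> a"
    from p(1) that show "p permutes ?A" by (auto intro: permutes_subset)
    from p show "?moved p = S" by (auto dest: permutes_not_in)
  qed
  have "fact n = (\<Sum>p | p permutes ?A. 1::nat)"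
    by (simp add: card_permutations[where n = n])
  also have "\<dots> = (\<Sum>S\<in>Pow ?A. \<Sum>p | p \<in> {p. p permutes ?A} \<and> ?moved p = S. 1)"
    by (intro sum.group[symmetric])
       (auto simp: finite_permutations dest: permutes_not_in[where S = ?A])
  also have "\<dots> = (\<Sum>S\<in>Pow ?A. derangement_number (card S))"
  proof (intro sum.cong refl)
    fix S assume S: "S \<in> Pow ?A"
    then have "finite S" by (auto intro: finite_subset)
    with moved[OF S] show "(\<Sum>p | p \<in> {p. p permutes ?A} \<and> ?moved p = S. 1) = derangement_number (card S)"
      by (simp add: card_derangements)
  qed
  also have "\<dots> = (\<Sum>k\<le>n. (n choose k) * derangement_number k)"
    by (subst sum_Pow_card) auto
  finally show ?thesis .
qed

text \<open>
  The identity \<open>n! = (\<Sum>k\<le>n. (n choose k) * D\<^sub>k)\<close> says \<open>D(t) * e\<^sup>t = 1 / (1 - t)\<close>;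
  multiplying by \<open>e\<^sup>-\<^sup>t\<close> isolates \<open>D(t)\<close>.
\<close>
lemma derangement_egf:
  "fps_exp (- 1) / (1 - fps_X) = Abs_fps (\<lambda>n. real (derangement_number n) / fact n)"
  (is "_ = ?D")
proof -
  have "?D * fps_exp 1 = Abs_fps (\<lambda>_. 1)"
  proof (rule fps_ext)
    fix n
    have "(?D * fps_exp 1) $ n = (\<Sum>k\<le>n. real (n choose k) * derangement_number k / fact n)"
      unfolding fps_mult_nth atMost_atLeast0 [symmetric]
      by (intro sum.cong) (auto simp: binomial_fact)
    also have "\<dots> = real (\<Sum>k\<le>n. (n choose k) * derangement_number k) / fact n"
      by (simp add: sum_divide_distrib)
    also have "\<dots> = 1"
      by (simp flip: fact_eq_sum_derangement_number)
    finally show "(?D * fps_exp 1) $ n = Abs_fps (\<lambda>_. 1) $ n" by simp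
  qed
  also have "\<dots> = inverse (1 - fps_X)"
    by (simp add: fps_inverse_one_minus_fps_X)
  finally have "?D * (fps_exp 1 * fps_exp (- 1)) = inverse (1 - fps_X) * fps_exp (- 1)"
    by (simp only: mult.assoc [symmetric])
  then show ?thesis
    by (simp add: fps_divide_unit mult.commute flip: fps_exp_add_mult)
qed

text \<open>
  The odd coefficients of the cosine series vanish, so an exponent \<open>j \<le> n\<close> contributes only as \<open>j = 2 * m\<close>
  with \<open>m \<le> n div 2\<close>. This is the source of the outer summation range up to \<open>n div 2\<close>.
\<close>
lemma fps_mult_cos_nth:
  fixes f :: "'a::field_char_0 fps"
  shows "(f * fps_cos c) $ n =
    (\<Sum>m = 0..n div 2. f $ (n - 2 * m) * ((- 1) ^ m * c ^ (2 * m) / fact (2 * m)))"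
proof -
  have "(f * fps_cos c) $ n = (\<Sum>j = 0..n. fps_cos c $ j * f $ (n - j))"
    by (simp add: fps_mult_nth mult.commute[of f])
  also have "\<dots> = (\<Sum>j\<in>(*) 2 ` {0..n div 2}. fps_cos c $ j * f $ (n - j))"
  proof (intro sum.mono_neutral_right ballI)
    fix j assume j: "j \<in> {0..n} - (*) 2 ` {0..n div 2}"
    have "odd j"
    proof
      assume "even j"
      then obtain m where "j = 2 * m" by (rule evenE)
      with j show False by auto
    qed
    then show "fps_cos c $ j * f $ (n - j) = 0" by (simp add: fps_cos_def)
  qed auto
  also have "\<dots> = (\<Sum>m = 0..n div 2. fps_cos c $ (2 * m) * f $ (n - 2 * m))"
    by (subst sum.reindex) (auto simp: inj_on_def)
  finally show ?thesis
    by (simp add: fps_cos_def mult.commute)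
qed

theorem theorem7:
  fixes n :: nat and x y :: real
  shows "cos_derangement_poly n x y =
    (\<Sum>m = 0..n div 2. \<Sum>k = 2 * m..n.
      real (n choose k) * real (k choose (2 * m)) * real (derangement_number (n - k))
        * (- 1) ^ m * y ^ (2 * m) * x ^ (k - 2 * m))"
proof -
  define D where "D = Abs_fps (\<lambda>n. real (derangement_number n) / fact n)"
  \<comment> \<open>The inner index is shifted by \<open>2 * m\<close>: \<open>k\<close> counts the exponents of the exponential and cosine
    factors together, so that \<open>D\<close> is always taken at \<open>n - k\<close>.\<close>
  have exp_D: "(D * fps_exp x) $ (n - 2 * m)
      = (\<Sum>k = 2 * m..n. D $ (n - k) * (x ^ (k - 2 * m) / fact (k - 2 * m)))"
    if "m \<in> {0..n div 2}" for m
  proof -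
    have "(D * fps_exp x) $ (n - 2 * m)
        = (\<Sum>i = 0..n - 2 * m. fps_exp x $ i * D $ (n - 2 * m - i))"
      by (simp only: fps_mult_nth mult.commute[of D])
    also have "\<dots> = (\<Sum>k = 2 * m..n. fps_exp x $ (k - 2 * m) * D $ (n - k))"
      using that
      by (intro sum.reindex_bij_witness[of _ "\<lambda>k. k - 2 * m" "\<lambda>i. i + 2 * m"])
         (auto simp: add.commute)
    finally show ?thesis by (simp add: mult.commute)
  qed
  have "cos_derangement_poly n x y = fact n * (D * fps_exp x * fps_cos y) $ n"
    by (simp add: cos_derangement_poly_def cos_derangement_gf_def derangement_egf D_def)
  also have "\<dots> = (\<Sum>m = 0..n div 2. \<Sum>k = 2 * m..n.
      fact n * (D $ (n - k) * (x ^ (k - 2 * m) / fact (k - 2 * m))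
        * ((- 1) ^ m * y ^ (2 * m) / fact (2 * m))))"
    by (simp only: fps_mult_cos_nth exp_D sum_distrib_left sum_distrib_right cong: sum.cong)
  also have "\<dots> = (\<Sum>m = 0..n div 2. \<Sum>k = 2 * m..n.
      real (n choose k) * real (k choose (2 * m)) * real (derangement_number (n - k))
        * (- 1) ^ m * y ^ (2 * m) * x ^ (k - 2 * m))"
    by (intro sum.cong refl) (simp add: D_def binomial_fact mult_ac)
  finally show ?thesis .
qed

end
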